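(* Let $a=1+a_2\mathbf{j}+a_3\mathbf{k}$ with $a_2^2+a_3^2=1$, $b=b_1\mathbf{i}+b_2\mathbf{j}+b_3\mathbf{k}\neq0$, $c=c_0+c_1\mathbf{i}+c_2\mathbf{j}+c_3\mathbf{k}$ be split quaternions (all coefficients real) with $P_{ab}\neq0$. Let $x_0,k_1,k_2,m,\Delta_1,\Delta_2,R,L,F$ be the real numbers defined from $(a,b,c)$ in the context. Then the equation $ax^2+bx+c=0$ has a solution $x\in SZ$ if and only if the following Condition 1 holds: (i) $F=0$, and (ii) if $R=0$ then $L=0$. If Condition 1 holds, then: (1) If $R\neq0$, the equation has the solution $$x=x_0-\frac{L}{R}\mathbf{i}+x_2\mathbf{j}+x_3\mathbf{k},\qquad x_2=-\frac{k_1L}{mR}+\frac{k_2}{m}x_0+\Delta_1,\qquad x_3=\frac{k_2L}{mR}+\frac{k_1}{m}x_0+\Delta_2.$$ (2) If $R=0$, the equation has the solutions $$x=x_0+x_1\mathbf{i}+\Big(\frac{k_1}{m}x_1+\frac{k_2}{m}x_0+\Delta_1\Big)\mathbf{j}+\Big(-\frac{k_2}{m}x_1+\frac{k_1}{m}x_0+\Delta_2\Big)\mathbf{k},\qquad \forall x_1\in\mathbb{R}.$$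
   Context: $\mathbb{H}_s$ is the real algebra of split quaternions $x=x_0+x_1\mathbf{i}+x_2\mathbf{j}+x_3\mathbf{k}$ ($x_i\in\mathbb{R}$), with $\mathbf{i}^2=-1$, $\mathbf{j}^2=\mathbf{k}^2=1$, $\mathbf{i}\mathbf{j}=\mathbf{k}=-\mathbf{j}\mathbf{i}$, $\mathbf{j}\mathbf{k}=-\mathbf{i}=-\mathbf{k}\mathbf{j}$, $\mathbf{k}\mathbf{i}=\mathbf{j}=-\mathbf{i}\mathbf{k}$. Put $I_x=x_0^2+x_1^2-x_2^2-x_3^2$ and $P_{xy}=x_0y_0+x_1y_1-x_2y_2-x_3y_3$; $Z(\mathbb{H}_s)=\{x: I_x=0\}$ is the set of zero divisors. For the equation $ax^2+bx+c=0$, $SZ=\{x\in\mathbb{H}_s: ax^2+bx+c=0\text{ and }2x_0a+b\in Z(\mathbb{H}_s)\}$, where $x_0$ is the real part of $x$. Notation attached to $(a,b,c)$ (with $P_{ab}=-a_2b_2-a_3b_3\ne0$): $\delta=a_2b_3-a_3b_2+b_1$, $t_1=c_2-c_0a_2-a_3c_1$, $t_2=c_3-c_0a_3+a_2c_1$, $$x_0=\frac{-I_b}{4P_{ab}},\quad k_1=2b_2\delta-a_3I_b,\quad k_2=-2b_3\delta-a_2I_b,\quad m=2b_1\delta-I_b,$$ $$\Delta_1=\frac{-P_{ab}t_1-\delta t_2}{m},\qquad \Delta_2=\frac{\delta t_1-P_{ab}t_2}{m},$$ $$R=\frac{2k_1\Delta_1-2k_2\Delta_2+b_2k_1-b_3k_2+2(a_2k_1-a_3k_2)x_0-mb_1}{m},$$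 $$L=b_2\Delta_1+b_3\Delta_2+\Delta_1^2+\Delta_2^2+c_0+\frac{2(a_2k_2+a_3k_1+m)}{m}x_0^2+\frac{2k_2\Delta_1+2k_1\Delta_2+b_2k_2+b_3k_1+2a_2\Delta_1m+2a_3\Delta_2m}{m}x_0,$$ $$F=\frac{2a_3k_2-2a_2k_1}{m}x_0^2+\Big(\frac{b_3k_2-b_2k_1}{m}+2a_3\Delta_1-2a_2\Delta_2+b_1\Big)x_0+b_3\Delta_1-b_2\Delta_2+c_1.$$ (Here $m=P_{ab}^2+\delta^2>0$.) *)

theory Defs
  imports Complex_Main
begin

section \<open>The algebra of split quaternions\<close>

datatype split_quat = SQuat (sq0: real) (sq1: real) (sq2: real) (sq3: real)

lemma split_quat_eq_iff:
  "x = y \<longleftrightarrow> sq0 x = sq0 y \<and> sq1 x = sq1 y \<and> sq2 x = sq2 y \<and> sq3 x = sq3 y"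
  by (cases x; cases y) auto

instantiation split_quat :: real_algebra_1
begin

definition "0 = SQuat 0 0 0 0"
definition "1 = SQuat 1 0 0 0"
definition "x + y = SQuat (sq0 x + sq0 y) (sq1 x + sq1 y) (sq2 x + sq2 y) (sq3 x + sq3 y)"
definition "x - y = SQuat (sq0 x - sq0 y) (sq1 x - sq1 y) (sq2 x - sq2 y) (sq3 x - sq3 y)"
definition "- x = SQuat (- sq0 x) (- sq1 x) (- sq2 x) (- sq3 x)"
definition "r *\<^sub>R x = SQuat (r * sq0 x) (r * sq1 x) (r * sq2 x) (r * sq3 x)"
definition "x * y = SQuat
  (sq0 x * sq0 y - sq1 x * sq1 y + sq2 x * sq2 y + sq3 x * sq3 y)
  (sq0 x * sq1 y + sq1 x * sq0 y - sq2 x * sq3 y + sq3 x * sq2 y)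
  (sq0 x * sq2 y + sq2 x * sq0 y - sq1 x * sq3 y + sq3 x * sq1 y)
  (sq0 x * sq3 y + sq3 x * sq0 y + sq1 x * sq2 y - sq2 x * sq1 y)"

instance
  by intro_classes
    (simp_all add: split_quat_eq_iff zero_split_quat_def one_split_quat_def plus_split_quat_def
      minus_split_quat_def uminus_split_quat_def scaleR_split_quat_def times_split_quat_def
      algebra_simps)

end

lemma split_quat_sel [simp]:
  "sq0 0 = 0" "sq1 0 = 0" "sq2 0 = 0" "sq3 0 = 0"
  "sq0 1 = 1" "sq1 1 = 0" "sq2 1 = 0" "sq3 1 = 0"
  "sq0 (x + y) = sq0 x + sq0 y" "sq1 (x + y) = sq1 x + sq1 y"
  "sq2 (x + y) = sq2 x + sq2 y" "sq3 (x + y) = sq3 x + sq3 y"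
  "sq0 (x - y) = sq0 x - sq0 y" "sq1 (x - y) = sq1 x - sq1 y"
  "sq2 (x - y) = sq2 x - sq2 y" "sq3 (x - y) = sq3 x - sq3 y"
  "sq0 (- x) = - sq0 x" "sq1 (- x) = - sq1 x" "sq2 (- x) = - sq2 x" "sq3 (- x) = - sq3 x"
  "sq0 (r *\<^sub>R x) = r * sq0 x" "sq1 (r *\<^sub>R x) = r * sq1 x"
  "sq2 (r *\<^sub>R x) = r * sq2 x" "sq3 (r *\<^sub>R x) = r * sq3 x"
  "sq0 (of_real r) = r" "sq1 (of_real r) = 0" "sq2 (of_real r) = 0" "sq3 (of_real r) = 0"
  by (simp_all add: zero_split_quat_def one_split_quat_def plus_split_quat_def of_real_def
      minus_split_quat_def uminus_split_quat_def scaleR_split_quat_def)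

lemma split_quat_sel_times:
  "sq0 (x * y) = sq0 x * sq0 y - sq1 x * sq1 y + sq2 x * sq2 y + sq3 x * sq3 y"
  "sq1 (x * y) = sq0 x * sq1 y + sq1 x * sq0 y - sq2 x * sq3 y + sq3 x * sq2 y"
  "sq2 (x * y) = sq0 x * sq2 y + sq2 x * sq0 y - sq1 x * sq3 y + sq3 x * sq1 y"
  "sq3 (x * y) = sq0 x * sq3 y + sq3 x * sq0 y + sq1 x * sq2 y - sq2 x * sq1 y"
  by (simp_all add: times_split_quat_def)

definition sq_i :: split_quat where "sq_i = SQuat 0 1 0 0"
definition sq_j :: split_quat where "sq_j = SQuat 0 0 1 0"
definition sq_k :: split_quat where "sq_k = SQuat 0 0 0 1"

lemma split_quat_sel_basis [simp]:
  "sq0 sq_i = 0" "sq1 sq_i = 1" "sq2 sq_i = 0" "sq3 sq_i = 0"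
  "sq0 sq_j = 0" "sq1 sq_j = 0" "sq2 sq_j = 1" "sq3 sq_j = 0"
  "sq0 sq_k = 0" "sq1 sq_k = 0" "sq2 sq_k = 0" "sq3 sq_k = 1"
  by (simp_all add: sq_i_def sq_j_def sq_k_def)

lemma split_quat_expand:
  "x = of_real (sq0 x) + sq1 x *\<^sub>R sq_i + sq2 x *\<^sub>R sq_j + sq3 x *\<^sub>R sq_k"
  by (simp add: split_quat_eq_iff)

lemma split_quat_mult_table:
  "sq_i * sq_i = - 1" "sq_j * sq_j = 1" "sq_k * sq_k = 1"
  "sq_i * sq_j = sq_k" "sq_j * sq_i = - sq_k"
  "sq_j * sq_k = - sq_i" "sq_k * sq_j = sq_i"
  "sq_k * sq_i = sq_j" "sq_i * sq_k = - sq_j"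
  by (simp_all add: split_quat_eq_iff split_quat_sel_times)

definition sq_I :: "split_quat \<Rightarrow> real" where
  "sq_I x = (sq0 x)\<^sup>2 + (sq1 x)\<^sup>2 - (sq2 x)\<^sup>2 - (sq3 x)\<^sup>2"

definition sq_P :: "split_quat \<Rightarrow> split_quat \<Rightarrow> real" where
  "sq_P x y = sq0 x * sq0 y + sq1 x * sq1 y - sq2 x * sq2 y - sq3 x * sq3 y"

definition zero_divisors :: "split_quat set" where
  "zero_divisors = {x. sq_I x = 0}"

text \<open>The name is justified (with \<open>0\<close> counted as a zero divisor).\<close>

lemma zero_divisors_iff: "x \<in> zero_divisors \<longleftrightarrow> (\<exists>y. y \<noteq> 0 \<and> x * y = 0)"
proof -
  define x' where "x' = SQuat (sq0 x) (- sq1 x) (- sq2 x) (- sq3 x)"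
  have xx': "x * x' = of_real (sq_I x)" "x' * x = of_real (sq_I x)"
    by (simp_all add: x'_def split_quat_eq_iff split_quat_sel_times sq_I_def power2_eq_square)
  show ?thesis
  proof
    assume x: "x \<in> zero_divisors"
    show "\<exists>y. y \<noteq> 0 \<and> x * y = 0"
    proof (cases "x = 0")
      case True
      then show ?thesis by (intro exI[of _ 1]) simp
    next
      case False
      then have "x' \<noteq> 0" by (simp add: x'_def split_quat_eq_iff)
      with x xx'(1) show ?thesis by (intro exI[of _ x']) (simp add: zero_divisors_def)
    qed
  next
    assume "\<exists>y. y \<noteq> 0 \<and> x * y = 0"
    then obtain y where y: "y \<noteq> 0" "x * y = 0" by blast
    have "(x' * x) * y = 0" using y(2) by (simp only: mult.assoc mult_zero_right)
    then have "sq_I x *\<^sub>R y = 0" by (simp add: xx'(2) of_real_def)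
    with y(1) have "sq_I x = 0" by (auto simp: split_quat_eq_iff)
    then show "x \<in> zero_divisors" by (simp add: zero_divisors_def)
  qed
qed

section \<open>The equation \<open>a x\<^sup>2 + b x + c = 0\<close>\<close>

definition SZ :: "split_quat \<Rightarrow> split_quat \<Rightarrow> split_quat \<Rightarrow> split_quat set" where
  "SZ a b c = {x. a * x\<^sup>2 + b * x + c = 0 \<and> (2 * sq0 x) *\<^sub>R a + b \<in> zero_divisors}"

text \<open>
  The quantities below are the coefficients \<open>\<delta>\<close>, \<open>t\<^sub>1\<close>, \<open>t\<^sub>2\<close>, \<open>x\<^sub>0\<close>, \<open>k\<^sub>1\<close>, \<open>k\<^sub>2\<close>, \<open>m\<close>,
  \<open>\<Delta>\<^sub>1\<close>, \<open>\<Delta>\<^sub>2\<close>, \<open>R\<close>, \<open>L\<close>, \<open>F\<close> of the equation, in this order. They are only meaningful for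
  \<open>a = 1 + a\<^sub>2 j + a\<^sub>3 k\<close> with \<open>a\<^sub>2\<^sup>2 + a\<^sub>3\<^sup>2 = 1\<close>, \<open>b\<close> with zero real part and \<open>P\<^sub>a\<^sub>b \<noteq> 0\<close>; then
  \<open>m = P\<^sub>a\<^sub>b\<^sup>2 + \<delta>\<^sup>2 > 0\<close>, so no division by zero occurs.
\<close>

definition qd :: "split_quat \<Rightarrow> split_quat \<Rightarrow> real" where
  "qd a b = sq2 a * sq3 b - sq3 a * sq2 b + sq1 b"

definition qt1 :: "split_quat \<Rightarrow> split_quat \<Rightarrow> real" where
  "qt1 a c = sq2 c - sq0 c * sq2 a - sq3 a * sq1 c"

definition qt2 :: "split_quat \<Rightarrow> split_quat \<Rightarrow> real" where
  "qt2 a c = sq3 c - sq0 c * sq3 a + sq2 a * sq1 c"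

definition qx0 :: "split_quat \<Rightarrow> split_quat \<Rightarrow> real" where
  "qx0 a b = - sq_I b / (4 * sq_P a b)"

definition qk1 :: "split_quat \<Rightarrow> split_quat \<Rightarrow> real" where
  "qk1 a b = 2 * sq2 b * qd a b - sq3 a * sq_I b"

definition qk2 :: "split_quat \<Rightarrow> split_quat \<Rightarrow> real" where
  "qk2 a b = - 2 * sq3 b * qd a b - sq2 a * sq_I b"

definition qm :: "split_quat \<Rightarrow> split_quat \<Rightarrow> real" where
  "qm a b = 2 * sq1 b * qd a b - sq_I b"

definition qD1 :: "split_quat \<Rightarrow> split_quat \<Rightarrow> split_quat \<Rightarrow> real" where
  "qD1 a b c = (- sq_P a b * qt1 a c - qd a b * qt2 a c) / qm a b"

definition qD2 :: "split_quat \<Rightarrow> split_quat \<Rightarrow> split_quat \<Rightarrow> real" where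
  "qD2 a b c = (qd a b * qt1 a c - sq_P a b * qt2 a c) / qm a b"

definition qR :: "split_quat \<Rightarrow> split_quat \<Rightarrow> split_quat \<Rightarrow> real" where
  "qR a b c =
    (let a2 = sq2 a; a3 = sq3 a; b1 = sq1 b; b2 = sq2 b; b3 = sq3 b;
         x0 = qx0 a b; k1 = qk1 a b; k2 = qk2 a b; m = qm a b; D1 = qD1 a b c; D2 = qD2 a b c
     in (2 * k1 * D1 - 2 * k2 * D2 + b2 * k1 - b3 * k2 + 2 * (a2 * k1 - a3 * k2) * x0 - m * b1) / m)"

definition qL :: "split_quat \<Rightarrow> split_quat \<Rightarrow> split_quat \<Rightarrow> real" where
  "qL a b c =
    (let a2 = sq2 a; a3 = sq3 a; b2 = sq2 b; b3 = sq3 b; c0 = sq0 c;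
         x0 = qx0 a b; k1 = qk1 a b; k2 = qk2 a b; m = qm a b; D1 = qD1 a b c; D2 = qD2 a b c
     in b2 * D1 + b3 * D2 + D1\<^sup>2 + D2\<^sup>2 + c0
        + 2 * (a2 * k2 + a3 * k1 + m) / m * x0\<^sup>2
        + (2 * k2 * D1 + 2 * k1 * D2 + b2 * k2 + b3 * k1 + 2 * a2 * D1 * m + 2 * a3 * D2 * m) / m * x0)"

definition qF :: "split_quat \<Rightarrow> split_quat \<Rightarrow> split_quat \<Rightarrow> real" where
  "qF a b c =
    (let a2 = sq2 a; a3 = sq3 a; b1 = sq1 b; b2 = sq2 b; b3 = sq3 b; c1 = sq1 c;
         x0 = qx0 a b; k1 = qk1 a b; k2 = qk2 a b; m = qm a b; D1 = qD1 a b c; D2 = qD2 a b c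
     in (2 * a3 * k2 - 2 * a2 * k1) / m * x0\<^sup>2
        + ((b3 * k2 - b2 * k1) / m + 2 * a3 * D1 - 2 * a2 * D2 + b1) * x0
        + b3 * D1 - b2 * D2 + c1)"

definition condition1 :: "split_quat \<Rightarrow> split_quat \<Rightarrow> split_quat \<Rightarrow> bool" where
  "condition1 a b c \<longleftrightarrow> qF a b c = 0 \<and> (qR a b c = 0 \<longrightarrow> qL a b c = 0)"

end

theory Submission
  imports Defs
begin

text \<open>
  Every split quaternion satisfies \<open>x\<^sup>2 = 2 x\<^sub>0 x - I\<^sub>x\<close>, so the equation reads
  \<open>(2 x\<^sub>0 a + b) x - I\<^sub>x a + c = 0\<close>. Since \<open>I\<^sub>a = 0\<close>, the form \<open>I\<close> evaluated at the coefficient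
  \<open>2 x\<^sub>0 a + b\<close> is affine in \<open>x\<^sub>0\<close>, with slope \<open>4 P\<^sub>a\<^sub>b \<noteq> 0\<close>: membership in \<open>SZ\<close> prescribes the
  real part of \<open>x\<close> (lemma \<open>leading_coeff_zero_divisor_iff\<close>).

  Multiplying the equation from the left by the conjugate of \<open>a\<close> removes the terms
  \<open>2 x\<^sub>0 a x\<close> and \<open>I\<^sub>x a\<close>, the only nonlinear ones, again because \<open>I\<^sub>a = 0\<close>. The \<open>j\<close> and \<open>k\<close> parts of the product form a linear
  system for \<open>(x\<^sub>2, x\<^sub>3)\<close> whose matrix has rows \<open>(P\<^sub>a\<^sub>b, - \<delta>)\<close> and \<open>(\<delta>, P\<^sub>a\<^sub>b)\<close> and determinant
  \<open>m > 0\<close>; hence \<open>x\<^sub>2\<close> and \<open>x\<^sub>3\<close> are affine functions of \<open>x\<^sub>1\<close>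
  (lemma \<open>conjugate_eliminates_norm\<close> and lemma \<open>linear_part_iff\<close>).

  It remains to substitute these functions in the real and \<open>i\<close> parts of the equation. As
  \<open>k\<^sub>1\<^sup>2 + k\<^sub>2\<^sup>2 = m\<^sup>2\<close>, the square \<open>x\<^sub>1\<^sup>2\<close> cancels in the real part, which becomes \<open>R x\<^sub>1 + L = 0\<close>; as
  \<open>2 x\<^sub>0 a + b\<close> is a zero divisor, \<open>x\<^sub>1\<close> disappears from the \<open>i\<close> part, which becomes \<open>F = 0\<close>
  (lemma \<open>mem_SZ_iff\<close>). Solvability of \<open>R x\<^sub>1 + L = 0\<close> then decides everything.
\<close>

section \<open>Squares, zero divisors and plane similarities\<close>

lemma split_quat_square: "x\<^sup>2 = (2 * sq0 x) *\<^sub>R x - of_real (sq_I x)"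
  by (simp add: split_quat_eq_iff power2_eq_square split_quat_sel_times sq_I_def algebra_simps)

text \<open>
  The quadratic form \<open>I\<close> has \<open>P\<close> as its polar form, whence the condition on \<open>r\<close> is affine when \<open>a\<close>
  is isotropic.
\<close>

lemma zero_divisor_pencil_iff:
  assumes "sq_I a = 0" and P: "sq_P a b \<noteq> 0"
  shows "(2 * r) *\<^sub>R a + b \<in> zero_divisors \<longleftrightarrow> r = - sq_I b / (4 * sq_P a b)"
proof -
  have "sq_I ((2 * r) *\<^sub>R a + b) = (2 * r)\<^sup>2 * sq_I a + 4 * r * sq_P a b + sq_I b"
    by (simp add: sq_I_def sq_P_def power2_eq_square algebra_simps)
  with assms show ?thesis
    by (auto simp: zero_divisors_def field_simps)
qed

text \<open>The matrix with rows \<open>(p, - d)\<close> and \<open>(d, p)\<close> is a similarity of the plane with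
  determinant \<open>p\<^sup>2 + d\<^sup>2\<close>; multiplying by its transpose isolates \<open>y\<close> and \<open>z\<close>.\<close>

lemma similarity_kernel_trivial:
  fixes p d y z :: real
  assumes "p \<noteq> 0"
  shows "p * y - d * z = 0 \<and> d * y + p * z = 0 \<longleftrightarrow> y = 0 \<and> z = 0"
proof
  assume *: "p * y - d * z = 0 \<and> d * y + p * z = 0"
  have "(p\<^sup>2 + d\<^sup>2) * y = p * (p * y - d * z) + d * (d * y + p * z)"
    by (simp add: power2_eq_square algebra_simps)
  also have "\<dots> = 0"
    using * by simp
  finally have y: "(p\<^sup>2 + d\<^sup>2) * y = 0" .
  have "(p\<^sup>2 + d\<^sup>2) * z = p * (d * y + p * z) - d * (p * y - d * z)"
    by (simp add: power2_eq_square algebra_simps)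
  also have "\<dots> = 0"
    using * by simp
  finally have z: "(p\<^sup>2 + d\<^sup>2) * z = 0" .
  have "p\<^sup>2 + d\<^sup>2 \<noteq> 0"
    using assms by (simp add: sum_power2_eq_zero_iff)
  then show "y = 0 \<and> z = 0"
    using y z by (simp only: mult_eq_0_iff) simp
qed simp

section \<open>Identities between the coefficients\<close>

locale isotropic_quadratic =
  fixes a b c :: split_quat and a2 a3 b1 b2 b3 c0 c1 c2 c3 :: real
  assumes a: "a = 1 + a2 *\<^sub>R sq_j + a3 *\<^sub>R sq_k" and a_norm: "a2\<^sup>2 + a3\<^sup>2 = 1"
    and b: "b = b1 *\<^sub>R sq_i + b2 *\<^sub>R sq_j + b3 *\<^sub>R sq_k"
    and c: "c = of_real c0 + c1 *\<^sub>R sq_i + c2 *\<^sub>R sq_j + c3 *\<^sub>R sq_k"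
    and P_nz: "sq_P a b \<noteq> 0"
begin

abbreviation "P \<equiv> sq_P a b"
abbreviation "d \<equiv> qd a b"
abbreviation "m \<equiv> qm a b"
abbreviation "x0 \<equiv> qx0 a b"

definition "u = qk1 a b / m"
definition "v = qk2 a b / m"

lemma coords:
  "sq0 a = 1" "sq1 a = 0" "sq2 a = a2" "sq3 a = a3"
  "sq0 b = 0" "sq1 b = b1" "sq2 b = b2" "sq3 b = b3"
  "sq0 c = c0" "sq1 c = c1" "sq2 c = c2" "sq3 c = c3"
  by (simp_all add: a b c)

lemma P_eq: "P = - a2 * b2 - a3 * b3"
  and d_eq: "d = a2 * b3 - a3 * b2 + b1"
  and I_eq: "sq_I b = b1\<^sup>2 - b2\<^sup>2 - b3\<^sup>2"
  by (simp_all add: sq_P_def qd_def sq_I_def coords)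

lemma k1_eq: "qk1 a b = 2 * b2 * d - a3 * sq_I b"
  and k2_eq: "qk2 a b = - 2 * b3 * d - a2 * sq_I b"
  and m_def: "m = 2 * b1 * d - sq_I b"
  by (simp_all add: qk1_def qk2_def qm_def coords)

text \<open>Lagrange's identity \<open>(a\<^sub>2 b\<^sub>2 + a\<^sub>3 b\<^sub>3)\<^sup>2 + (a\<^sub>2 b\<^sub>3 - a\<^sub>3 b\<^sub>2)\<^sup>2 = b\<^sub>2\<^sup>2 + b\<^sub>3\<^sup>2\<close> for the unit vector
  \<open>(a\<^sub>2, a\<^sub>3)\<close>.\<close>

lemma m_eq: "m = P\<^sup>2 + d\<^sup>2"
proof -
  \<comment> \<open>As in later proofs, the constraint on \<open>a\<close> enters through an explicit multiple of
    \<open>a\<^sub>2\<^sup>2 + a\<^sub>3\<^sup>2 - 1\<close>, so that what remains is an identity of polynomials.\<close>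
  have "m = P\<^sup>2 + d\<^sup>2 - (a2\<^sup>2 + a3\<^sup>2 - 1) * (b2\<^sup>2 + b3\<^sup>2)"
    unfolding m_def P_eq d_eq I_eq by (simp add: power2_eq_square algebra_simps)
  then show ?thesis
    by (simp add: a_norm)
qed

lemma m_pos: "m > 0"
  unfolding m_eq using P_nz by (simp add: add_pos_nonneg)

lemma unit_circle: "u\<^sup>2 + v\<^sup>2 = 1"
proof -
  have "(qk1 a b)\<^sup>2 + (qk2 a b)\<^sup>2 = m\<^sup>2 + (a2\<^sup>2 + a3\<^sup>2 - 1) * (sq_I b)\<^sup>2"
    unfolding k1_eq k2_eq m_def d_eq I_eq by (simp add: power2_eq_square algebra_simps)
  then show ?thesis
    using m_pos by (simp add: a_norm u_def v_def power_divide flip: add_divide_distrib)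
qed

text \<open>
  In the linear system of \<open>linear_part_iff\<close>, the vectors \<open>(u, -v)\<close>, \<open>(v, u)\<close> and
  \<open>(\<Delta>\<^sub>1, \<Delta>\<^sub>2)\<close> solve for \<open>(x\<^sub>2, x\<^sub>3)\<close> against, respectively, the coefficients of \<open>x\<^sub>1\<close>, those of
  \<open>x\<^sub>0\<close>, and the constants. The two identities of \<open>direction_response\<close> serve both of the first two
  vectors, which differ by a quarter turn that commutes with the matrix.
\<close>

lemma direction_response:
  "P * u + d * v = - (b3 + a2 * b1)"
  "d * u - P * v = b2 - a3 * b1"
proof -
  have "P * qk1 a b + d * qk2 a b = - (b3 + a2 * b1) * m + (a2\<^sup>2 + a3\<^sup>2 - 1) * (sq_I b * b3)"
    "d * qk1 a b - P * qk2 a b = (b2 - a3 * b1) * m - (a2\<^sup>2 + a3\<^sup>2 - 1) * (sq_I b * b2)"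
    unfolding k1_eq k2_eq m_def P_eq d_eq I_eq by (simp_all add: power2_eq_square algebra_simps)
  then show "P * u + d * v = - (b3 + a2 * b1)" "d * u - P * v = b2 - a3 * b1"
    using m_pos by (simp_all add: a_norm u_def v_def divide_simps)
qed

lemma offset_response:
  "P * qD1 a b c - d * qD2 a b c = - qt1 a c"
  "d * qD1 a b c + P * qD2 a b c = - qt2 a c"
proof -
  have "P * (- P * qt1 a c - d * qt2 a c) - d * (d * qt1 a c - P * qt2 a c) = - qt1 a c * m"
    "d * (- P * qt1 a c - d * qt2 a c) + P * (d * qt1 a c - P * qt2 a c) = - qt2 a c * m"
    unfolding m_eq by (simp_all add: power2_eq_square algebra_simps)
  then show "P * qD1 a b c - d * qD2 a b c = - qt1 a c"
    "d * qD1 a b c + P * qD2 a b c = - qt2 a c"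
    using m_pos by (simp_all add: qD1_def qD2_def divide_simps)
qed

text \<open>
  This is where the zero divisor \<open>2 x\<^sub>0 a + b\<close> enters: the left-hand side is the coefficient of \<open>x\<^sub>1\<close>
  in the \<open>i\<close> part of the equation once \<open>x\<^sub>2\<close> and \<open>x\<^sub>3\<close> are eliminated.
\<close>

lemma i_part_slope: "2 * x0 + (2 * x0 * a2 + b2) * v + (2 * x0 * a3 + b3) * u = 0"
proof -
  have x0: "4 * P * x0 = - sq_I b"
    using P_nz by (simp add: qx0_def)
  have "m + a2 * qk2 a b + a3 * qk1 a b
      = 2 * P\<^sup>2 - (a2\<^sup>2 + a3\<^sup>2 - 1) * (b1\<^sup>2 + b2\<^sup>2 + b3\<^sup>2)"
    unfolding k1_eq k2_eq m_def P_eq d_eq I_eq by (simp add: power2_eq_square algebra_simps)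
  then have sum1: "m + a2 * qk2 a b + a3 * qk1 a b = 2 * P\<^sup>2"
    by (simp add: a_norm)
  have sum2: "b2 * qk2 a b + b3 * qk1 a b = P * sq_I b"
    unfolding k1_eq k2_eq P_eq by (simp add: algebra_simps)
  have "2 * x0 * m + (2 * x0 * a2 + b2) * qk2 a b + (2 * x0 * a3 + b3) * qk1 a b
    = 2 * x0 * (m + a2 * qk2 a b + a3 * qk1 a b) + (b2 * qk2 a b + b3 * qk1 a b)"
    by (simp add: algebra_simps)
  also have "\<dots> = P * (4 * P * x0 + sq_I b)"
    unfolding sum1 sum2 by (simp add: power2_eq_square algebra_simps)
  finally show ?thesis
    using m_pos x0 by (simp add: u_def v_def divide_simps)
qed

section \<open>Reduction of the equation to a linear system\<close>

lemma leading_coeff_zero_divisor_iff: "(2 * sq0 x) *\<^sub>R a + b \<in> zero_divisors \<longleftrightarrow> sq0 x = x0"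
proof -
  have "sq_I a = 0"
    using a_norm by (simp add: sq_I_def coords)
  then show ?thesis
    using P_nz by (simp add: zero_divisor_pencil_iff qx0_def)
qed

text \<open>
  The two combinations are the \<open>j\<close> and \<open>k\<close> parts of the conjugate of \<open>a\<close> times \<open>y\<close>; together with
  the real and \<open>i\<close> parts of \<open>y\<close> they determine \<open>y\<close>.
\<close>

lemma split_quat_zero_iff_conjugate:
  "y = 0 \<longleftrightarrow> sq0 y = 0 \<and> sq1 y = 0 \<and>
    sq2 y - a2 * sq0 y - a3 * sq1 y = 0 \<and> sq3 y - a3 * sq0 y + a2 * sq1 y = 0"
  by (auto simp: split_quat_eq_iff)

lemma conjugate_eliminates_norm:
  assumes "y = a * x\<^sup>2 + b * x + c"
  shows "sq2 y - a2 * sq0 y - a3 * sq1 y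
      = P * sq2 x - d * sq3 x + (b3 + a2 * b1) * sq1 x + (b2 - a3 * b1) * sq0 x + qt1 a c"
    and "sq3 y - a3 * sq0 y + a2 * sq1 y
      = d * sq2 x + P * sq3 x + (a3 * b1 - b2) * sq1 x + (b3 + a2 * b1) * sq0 x + qt2 a c"
proof -
  have y: "y = a * ((2 * sq0 x) *\<^sub>R x - of_real (sq_I x)) + b * x + c"
    by (simp only: assms split_quat_square)
  have "sq2 y - a2 * sq0 y - a3 * sq1 y
      = P * sq2 x - d * sq3 x + (b3 + a2 * b1) * sq1 x + (b2 - a3 * b1) * sq0 x + qt1 a c
        - (a2\<^sup>2 + a3\<^sup>2 - 1) * (2 * sq0 x * sq2 x)"
    unfolding P_eq d_eq
    by (simp add: y split_quat_sel_times coords qt1_def)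
      (simp add: power2_eq_square algebra_simps)
  then show "sq2 y - a2 * sq0 y - a3 * sq1 y
      = P * sq2 x - d * sq3 x + (b3 + a2 * b1) * sq1 x + (b2 - a3 * b1) * sq0 x + qt1 a c"
    by (simp add: a_norm)
  have "sq3 y - a3 * sq0 y + a2 * sq1 y
      = d * sq2 x + P * sq3 x + (a3 * b1 - b2) * sq1 x + (b3 + a2 * b1) * sq0 x + qt2 a c
        - (a2\<^sup>2 + a3\<^sup>2 - 1) * (2 * sq0 x * sq3 x)"
    unfolding P_eq d_eq
    by (simp add: y split_quat_sel_times coords qt2_def)
      (simp add: power2_eq_square algebra_simps)
  then show "sq3 y - a3 * sq0 y + a2 * sq1 y
      = d * sq2 x + P * sq3 x + (a3 * b1 - b2) * sq1 x + (b3 + a2 * b1) * sq0 x + qt2 a c"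
    by (simp add: a_norm)
qed

text \<open>
  By the two response lemmas the system says that the deviation of \<open>(x\<^sub>2, x\<^sub>3)\<close> from the asserted
  solution lies in the kernel of a similarity.
\<close>

lemma linear_part_iff:
  "P * x2 - d * x3 + (b3 + a2 * b1) * x1 + (b2 - a3 * b1) * r + qt1 a c = 0 \<and>
   d * x2 + P * x3 + (a3 * b1 - b2) * x1 + (b3 + a2 * b1) * r + qt2 a c = 0 \<longleftrightarrow>
   x2 = u * x1 + v * r + qD1 a b c \<and> x3 = - v * x1 + u * r + qD2 a b c"
    (is "?e1 = 0 \<and> ?e2 = 0 \<longleftrightarrow> x2 = ?s2 \<and> x3 = ?s3")
proof -
  have zero: "P * u + d * v + (b3 + a2 * b1) = 0" "d * u - P * v - (b2 - a3 * b1) = 0"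
    "P * qD1 a b c - d * qD2 a b c + qt1 a c = 0" "d * qD1 a b c + P * qD2 a b c + qt2 a c = 0"
    by (simp_all add: direction_response offset_response)
  have "?e1 = P * (x2 - ?s2) - d * (x3 - ?s3)
      + (P * u + d * v + (b3 + a2 * b1)) * x1 - (d * u - P * v - (b2 - a3 * b1)) * r
      + (P * qD1 a b c - d * qD2 a b c + qt1 a c)"
    by (simp add: algebra_simps)
  also have "\<dots> = P * (x2 - ?s2) - d * (x3 - ?s3)"
    unfolding zero by simp
  finally have e1: "?e1 = P * (x2 - ?s2) - d * (x3 - ?s3)" .
  have "?e2 = d * (x2 - ?s2) + P * (x3 - ?s3)
      + (d * u - P * v - (b2 - a3 * b1)) * x1 + (P * u + d * v + (b3 + a2 * b1)) * r
      + (d * qD1 a b c + P * qD2 a b c + qt2 a c)"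
    by (simp add: algebra_simps)
  also have "\<dots> = d * (x2 - ?s2) + P * (x3 - ?s3)"
    unfolding zero by simp
  finally have e2: "?e2 = d * (x2 - ?s2) + P * (x3 - ?s3)" .
  show ?thesis
    unfolding e1 e2 similarity_kernel_trivial[OF P_nz] by (simp only: right_minus_eq)
qed

section \<open>The remaining two scalar equations\<close>

lemma k_eq: "qk1 a b = m * u" "qk2 a b = m * v"
  using m_pos by (simp_all add: u_def v_def)

lemma R_eq:
  "qR a b c = 2 * u * qD1 a b c - 2 * v * qD2 a b c + b2 * u - b3 * v
    + 2 * (a2 * u - a3 * v) * x0 - b1"
proof -
  have nz: "m \<noteq> 0"
    using m_pos by simp
  show ?thesis
    unfolding qR_def Let_def coords k_eq nonzero_divide_eq_eq[OF nz]
    by (simp add: algebra_simps)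
qed

lemma L_eq:
  "qL a b c = b2 * qD1 a b c + b3 * qD2 a b c + (qD1 a b c)\<^sup>2 + (qD2 a b c)\<^sup>2 + c0
    + 2 * (a2 * v + a3 * u + 1) * x0\<^sup>2
    + (2 * v * qD1 a b c + 2 * u * qD2 a b c + b2 * v + b3 * u
       + 2 * a2 * qD1 a b c + 2 * a3 * qD2 a b c) * x0"
proof -
  have nz: "m \<noteq> 0"
    using m_pos by simp
  have "2 * (a2 * qk2 a b + a3 * qk1 a b + m) / m = 2 * (a2 * v + a3 * u + 1)"
    and "(2 * qk2 a b * qD1 a b c + 2 * qk1 a b * qD2 a b c + b2 * qk2 a b + b3 * qk1 a b
        + 2 * a2 * qD1 a b c * m + 2 * a3 * qD2 a b c * m) / m
      = 2 * v * qD1 a b c + 2 * u * qD2 a b c + b2 * v + b3 * u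
        + 2 * a2 * qD1 a b c + 2 * a3 * qD2 a b c"
    unfolding k_eq nonzero_divide_eq_eq[OF nz] by (simp_all add: algebra_simps)
  then show ?thesis
    by (simp only: qL_def Let_def coords)
qed

lemma F_eq:
  "qF a b c = (2 * a3 * v - 2 * a2 * u) * x0\<^sup>2
    + (b3 * v - b2 * u + 2 * a3 * qD1 a b c - 2 * a2 * qD2 a b c + b1) * x0
    + b3 * qD1 a b c - b2 * qD2 a b c + c1"
  by (simp add: qF_def Let_def coords u_def v_def diff_divide_distrib)

text \<open>
  Substitution in the norm form gives \<open>x\<^sub>2\<^sup>2 + x\<^sub>3\<^sup>2 = x\<^sub>1\<^sup>2 + x\<^sub>0\<^sup>2\<close> up to terms of degree at most one
  in \<open>x\<^sub>1\<close> and \<open>x\<^sub>0\<close>, because \<open>(u, -v)\<close> and \<open>(v, u)\<close> are orthonormal; hence no \<open>x\<^sub>1\<^sup>2\<close> survives in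
  the real part.
\<close>

lemma real_and_i_parts:
  assumes "y = a * x\<^sup>2 + b * x + c" and x0: "sq0 x = x0"
    and x2: "sq2 x = u * sq1 x + v * x0 + qD1 a b c"
    and x3: "sq3 x = - v * sq1 x + u * x0 + qD2 a b c"
  shows "sq0 y = qR a b c * sq1 x + qL a b c" and "sq1 y = qF a b c"
proof -
  have y: "y = a * ((2 * sq0 x) *\<^sub>R x - of_real (sq_I x)) + b * x + c"
    by (simp only: assms(1) split_quat_square)
  have "sq0 y = 2 * (sq0 x)\<^sup>2 - b1 * sq1 x + (2 * sq0 x * a2 + b2) * sq2 x
      + (2 * sq0 x * a3 + b3) * sq3 x - sq_I x + c0"
    by (simp add: y split_quat_sel_times coords power2_eq_square) (simp add: algebra_simps)
  then have "sq0 y = qR a b c * sq1 x + qL a b c + (u\<^sup>2 + v\<^sup>2 - 1) * ((sq1 x)\<^sup>2 + x0\<^sup>2)"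
    unfolding R_eq L_eq sq_I_def x0 x2 x3 by (simp add: power2_eq_square algebra_simps)
  then show "sq0 y = qR a b c * sq1 x + qL a b c"
    by (simp add: unit_circle)
  have "sq1 y = qF a b c + (2 * x0 + (2 * x0 * a2 + b2) * v + (2 * x0 * a3 + b3) * u) * sq1 x"
    unfolding F_eq
    by (simp add: y split_quat_sel_times coords x0 x2 x3)
      (simp add: power2_eq_square algebra_simps)
  then show "sq1 y = qF a b c"
    by (simp add: i_part_slope)
qed

lemma mem_SZ_iff:
  "x \<in> SZ a b c \<longleftrightarrow> sq0 x = x0 \<and>
    sq2 x = u * sq1 x + v * x0 + qD1 a b c \<and> sq3 x = - v * sq1 x + u * x0 + qD2 a b c \<and>
    qF a b c = 0 \<and> qR a b c * sq1 x + qL a b c = 0"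
proof (cases "sq0 x = x0")
  case True
  define y where "y = a * x\<^sup>2 + b * x + c"
  have "x \<in> SZ a b c \<longleftrightarrow> y = 0"
    using True by (simp add: SZ_def leading_coeff_zero_divisor_iff y_def)
  also have "\<dots> \<longleftrightarrow> sq0 y = 0 \<and> sq1 y = 0 \<and>
      sq2 x = u * sq1 x + v * x0 + qD1 a b c \<and> sq3 x = - v * sq1 x + u * x0 + qD2 a b c"
    unfolding split_quat_zero_iff_conjugate[of y] conjugate_eliminates_norm[OF y_def]
      linear_part_iff True ..
  also have "\<dots> \<longleftrightarrow> sq2 x = u * sq1 x + v * x0 + qD1 a b c \<and>
      sq3 x = - v * sq1 x + u * x0 + qD2 a b c \<and>
      qF a b c = 0 \<and> qR a b c * sq1 x + qL a b c = 0"
    using real_and_i_parts[OF y_def True] by auto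
  finally show ?thesis
    using True by simp
qed (simp add: SZ_def leading_coeff_zero_divisor_iff)

lemma SZ_param:
  "SZ a b c = {of_real x0 + x1 *\<^sub>R sq_i + (u * x1 + v * x0 + qD1 a b c) *\<^sub>R sq_j
      + (- v * x1 + u * x0 + qD2 a b c) *\<^sub>R sq_k
    | x1. qF a b c = 0 \<and> qR a b c * x1 + qL a b c = 0}"
  by (auto simp: mem_SZ_iff split_quat_eq_iff)

end

section \<open>The solution set\<close>

theorem theorem3p1:
  fixes a b c :: split_quat
    and a2 a3 b1 b2 b3 c0 c1 c2 c3 :: real
  assumes a: "a = 1 + a2 *\<^sub>R sq_j + a3 *\<^sub>R sq_k" and a_norm: "a2\<^sup>2 + a3\<^sup>2 = 1"
    and b: "b = b1 *\<^sub>R sq_i + b2 *\<^sub>R sq_j + b3 *\<^sub>R sq_k" and b_nz: "b \<noteq> 0"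
    and c: "c = of_real c0 + c1 *\<^sub>R sq_i + c2 *\<^sub>R sq_j + c3 *\<^sub>R sq_k"
    and P_nz: "sq_P a b \<noteq> 0"
  shows "((\<exists>x. x \<in> SZ a b c) \<longleftrightarrow> condition1 a b c) \<and>
    (condition1 a b c \<longrightarrow>
      (let x0 = qx0 a b; k1 = qk1 a b; k2 = qk2 a b; m = qm a b;
           D1 = qD1 a b c; D2 = qD2 a b c; R = qR a b c; L = qL a b c
       in (R \<noteq> 0 \<longrightarrow>
            SZ a b c =
              {of_real x0 - (L / R) *\<^sub>R sq_i
                + (- (k1 * L) / (m * R) + k2 / m * x0 + D1) *\<^sub>R sq_j
                + (k2 * L / (m * R) + k1 / m * x0 + D2) *\<^sub>R sq_k}) \<and>
          (R = 0 \<longrightarrow>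
            SZ a b c =
              {of_real x0 + x1 *\<^sub>R sq_i
                + (k1 / m * x1 + k2 / m * x0 + D1) *\<^sub>R sq_j
                + (- (k2 / m) * x1 + k1 / m * x0 + D2) *\<^sub>R sq_k | x1. True})))"
proof -
  interpret isotropic_quadratic a b c a2 a3 b1 b2 b3 c0 c1 c2 c3
    using a a_norm b c P_nz by unfold_locales
  have root: "qR a b c * x1 + qL a b c = 0 \<longleftrightarrow> x1 = - (qL a b c / qR a b c)"
    if "qR a b c \<noteq> 0" for x1
    using that by (auto simp: field_simps)
  have solvable: "(\<exists>x. x \<in> SZ a b c) \<longleftrightarrow> condition1 a b c"
    by (cases "qR a b c = 0") (auto simp: SZ_param condition1_def root)
  have unique: "SZ a b c =
      {of_real x0 - (qL a b c / qR a b c) *\<^sub>R sq_i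
        + (- (qk1 a b * qL a b c) / (m * qR a b c) + qk2 a b / m * x0 + qD1 a b c) *\<^sub>R sq_j
        + (qk2 a b * qL a b c / (m * qR a b c) + qk1 a b / m * x0 + qD2 a b c) *\<^sub>R sq_k}"
    if "condition1 a b c" "qR a b c \<noteq> 0"
    using that by (auto simp: SZ_param condition1_def root u_def v_def) (simp add: mult.commute)
  have line: "SZ a b c =
      {of_real x0 + x1 *\<^sub>R sq_i + (qk1 a b / m * x1 + qk2 a b / m * x0 + qD1 a b c) *\<^sub>R sq_j
        + (- (qk2 a b / m) * x1 + qk1 a b / m * x0 + qD2 a b c) *\<^sub>R sq_k | x1. True}"
    if "condition1 a b c" "qR a b c = 0"
    using that by (simp add: SZ_param condition1_def u_def v_def)
  show ?thesis
    unfolding Let_def using solvable unique line by blast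
qed

end
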